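(* Consider the linear system $x(k+1)=Fx(k)+Gu(k)$, $y(k)=Hx(k)$, with $x(k)\in\mathbb R^n$, $u(k)\in\mathbb R^m$, and cost $c(x,u)=\|Hx\|^2+u^{\intercal}Ru$ with $R>0$; let $S=H^{\intercal}H$. Suppose that $(F,G)$ is stabilizable and $(F,H)$ is detectable, so that $J^\star$ is everywhere finite. Then the value function and Q-function are each quadratic: $J^\star(x)=x^{\intercal}M^\star x$ for each $x$, where $M^\star\ge 0$ is a solution to the algebraic Riccati equation $$M=F^{\intercal}MF+S-F^{\intercal}MG\,(R+G^{\intercal}MG)^{-1}G^{\intercal}MF,$$ and, with $z^{\intercal}=(x^{\intercal},u^{\intercal})$, $$Q^\star(x,u)=z^{\intercal}\left(\begin{bmatrix}S&0\\0&R\end{bmatrix}+\begin{bmatrix}F^{\intercal}M^\star F&F^{\intercal}M^\star G\\ G^{\intercal}M^\star F&G^{\intercal}M^\star G\end{bmatrix}\right)z .$$ The matrix $M^\star$ is also the solution to the following convex program: $$\begin{aligned}M^\star\in\operatorname*{arg\,max}_{M}\quad &\operatorname{trace}(M)\\ \text{s.t.}\quad &\begin{bmatrix}S&0\\0&R\end{bmatrix}+\begin{bmatrix}F^{\intercal}MF&F^{\intercal}MG\\ G^{\intercal}MF&G^{\intercal}MG\end{bmatrix}\ \ge\ \begin{bmatrix}M&0\\0&0\end{bmatrix},\end{aligned}$$ where the maximum is over symmetric $n\times n$ matrices $M$, and the inequality constraint is in the sense of symmetric matrices.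
   Context: $F,G,H$ are real matrices of suitable dimension ($F$ is $n\times n$), and $R$ is symmetric positive definite. The value function is $J^\star(x)=\min_{\boldsymbol u}\sum_{k=0}^\infty c(x(k),u(k))$ with $x(0)=x$, the minimum over all input sequences $\boldsymbol u=\{u(k)\}$, and the Q-function is $Q^\star(x,u)=c(x,u)+J^\star(Fx+Gu)$. For symmetric matrices, $A\ge B$ means $A-B$ is positive semi-definite. *)

theory Defs
  imports "HOL-Analysis.Analysis"
begin

definition symmetric_mat :: "real^'n^'n \<Rightarrow> bool" where
  "symmetric_mat A \<longleftrightarrow> transpose A = A"

definition pos_semidef :: "real^'n^'n \<Rightarrow> bool" where
  "pos_semidef A \<longleftrightarrow> symmetric_mat A \<and> (\<forall>x. 0 \<le> x \<bullet> (A *v x))"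

definition pos_def :: "real^'n^'n \<Rightarrow> bool" where
  "pos_def A \<longleftrightarrow> symmetric_mat A \<and> (\<forall>x. x \<noteq> 0 \<longrightarrow> 0 < x \<bullet> (A *v x))"

definition loewner_ge :: "real^'n^'n \<Rightarrow> real^'n^'n \<Rightarrow> bool" (infix "\<succeq>\<^sub>L" 50) where
  "A \<succeq>\<^sub>L B \<longleftrightarrow> pos_semidef (A - B)"

(* Block vectors and matrices are indexed by the disjoint sum of the index types. *)
definition stack :: "real^'n \<Rightarrow> real^'m \<Rightarrow> real^('n + 'm)" where
  "stack x u = (\<chi> i. case i of Inl a \<Rightarrow> x $ a | Inr b \<Rightarrow> u $ b)"

definition block_mat ::
  "real^'n^'n \<Rightarrow> real^'m^'n \<Rightarrow> real^'n^'m \<Rightarrow> real^'m^'m \<Rightarrow> real^('n + 'm)^('n + 'm)" where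
  "block_mat A B C D = (\<chi> i j.
     case i of
       Inl a \<Rightarrow> (case j of Inl a' \<Rightarrow> A $ a $ a' | Inr b' \<Rightarrow> B $ a $ b')
     | Inr b \<Rightarrow> (case j of Inl a' \<Rightarrow> C $ b $ a' | Inr b' \<Rightarrow> D $ b $ b'))"

(* Discrete-time stability: every complex eigenvalue lies in the open unit disc. *)
definition schur_stable :: "real^'n^'n \<Rightarrow> bool" where
  "schur_stable A \<longleftrightarrow>
     (\<forall>(\<mu>::complex) (v::complex^'n).
        v \<noteq> 0 \<and> map_matrix complex_of_real A *v v = \<mu> *s v \<longrightarrow> cmod \<mu> < 1)"

definition stabilizable :: "real^'n^'n \<Rightarrow> real^'m^'n \<Rightarrow> bool" where
  "stabilizable F G \<longleftrightarrow> (\<exists>K :: real^'n^'m. schur_stable (F + G ** K))"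

definition detectable :: "real^'n^'n \<Rightarrow> real^'n^'p \<Rightarrow> bool" where
  "detectable F H \<longleftrightarrow> (\<exists>L :: real^'p^'n. schur_stable (F + L ** H))"

primrec state_traj ::
  "real^'n^'n \<Rightarrow> real^'m^'n \<Rightarrow> real^'n \<Rightarrow> (nat \<Rightarrow> real^'m) \<Rightarrow> nat \<Rightarrow> real^'n" where
  "state_traj F G x u 0 = x"
| "state_traj F G x u (Suc k) = F *v state_traj F G x u k + G *v u k"

definition stage_cost :: "real^'n^'p \<Rightarrow> real^'m^'m \<Rightarrow> real^'n \<Rightarrow> real^'m \<Rightarrow> real" where
  "stage_cost H R x u = (norm (H *v x))\<^sup>2 + u \<bullet> (R *v u)"

(* Stage costs are nonnegative when R is positive definite, so the extended-real series is
   well defined; it equals infinity exactly when the real series diverges. *)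
definition total_cost ::
  "real^'n^'n \<Rightarrow> real^'m^'n \<Rightarrow> real^'n^'p \<Rightarrow> real^'m^'m \<Rightarrow> real^'n \<Rightarrow> (nat \<Rightarrow> real^'m) \<Rightarrow> ereal" where
  "total_cost F G H R x u = (\<Sum>k. ereal (stage_cost H R (state_traj F G x u k) (u k)))"

(* The value function is an infimum; that it is attained is a separate assertion. *)
definition value_fun ::
  "real^'n^'n \<Rightarrow> real^'m^'n \<Rightarrow> real^'n^'p \<Rightarrow> real^'m^'m \<Rightarrow> real^'n \<Rightarrow> ereal" where
  "value_fun F G H R x = (INF u. total_cost F G H R x u)"

definition Q_fun ::
  "real^'n^'n \<Rightarrow> real^'m^'n \<Rightarrow> real^'n^'p \<Rightarrow> real^'m^'m \<Rightarrow> real^'n \<Rightarrow> real^'m \<Rightarrow> ereal" where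
  "Q_fun F G H R x u = ereal (stage_cost H R x u) + value_fun F G H R (F *v x + G *v u)"

(* matrix_inv is unspecified on singular matrices, hence the explicit invertibility. *)
definition solves_ARE ::
  "real^'n^'n \<Rightarrow> real^'m^'n \<Rightarrow> real^'n^'p \<Rightarrow> real^'m^'m \<Rightarrow> real^'n^'n \<Rightarrow> bool" where
  "solves_ARE F G H R M \<longleftrightarrow>
     invertible (R + transpose G ** M ** G) \<and>
     M = transpose F ** M ** F + transpose H ** H
         - transpose F ** M ** G ** matrix_inv (R + transpose G ** M ** G)
             ** transpose G ** M ** F"

definition Q_mat ::
  "real^'n^'n \<Rightarrow> real^'m^'n \<Rightarrow> real^'n^'p \<Rightarrow> real^'m^'m \<Rightarrow> real^'n^'n \<Rightarrow> real^('n + 'm)^('n + 'm)" where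
  "Q_mat F G H R M =
     block_mat (transpose H ** H) 0 0 R
     + block_mat (transpose F ** M ** F) (transpose F ** M ** G)
                 (transpose G ** M ** F) (transpose G ** M ** G)"

definition program_feasible ::
  "real^'n^'n \<Rightarrow> real^'m^'n \<Rightarrow> real^'n^'p \<Rightarrow> real^'m^'m \<Rightarrow> (real^'n^'n) set" where
  "program_feasible F G H R =
     {M. symmetric_mat M \<and> Q_mat F G H R M \<succeq>\<^sub>L block_mat M 0 0 0}"

end

theory Submission
  imports Defs "HOL-Computational_Algebra.Fundamental_Theorem_Algebra"
begin

text \<open>
  The proof turns on one reading of the linear matrix inequality. Evaluated at a stacked vector
  (x, u), it is the Bellman inequality
  \<open>x'Mx \<le> c(x,u) + (Fx+Gu)'M(Fx+Gu)\<close> (lemma \<open>program_feasible_iff\<close>). Summed along a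
  trajectory it bounds \<open>x'Mx\<close> by the cost of the first \<open>N\<close> steps plus \<open>x\<^sub>N'Mx\<^sub>N\<close>. If the total
  cost is finite then the inputs and outputs are square summable; detectability presents the state
  as a stable system driven by these signals, so it tends to 0 and the last term disappears. Hence
  every feasible \<open>M\<close> lies below the cost of every input
  (\<open>feasible_qform_le_total_cost\<close>).

  By stabilizability some input has finite cost from each initial state, so the positive
  semidefinite feasible matrices form a compact set, and one of them, \<open>M\<close>, has maximal trace.
  Let \<open>Ric\<close> be the right-hand side of the Riccati equation. Completing the square shows that
  \<open>x' Ric(M) x\<close> is the minimum over \<open>u\<close> of the right-hand side of the Bellman inequality.
  Therefore \<open>Ric(M)\<close> dominates \<open>M\<close>, and replacing \<open>M\<close> by \<open>Ric(M)\<close> on the right shows that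
  \<open>Ric(M)\<close> is feasible too. Maximality of the trace forces \<open>Ric(M) = M\<close>
  (\<open>riccati_fixpoint_exists\<close>), since a positive semidefinite matrix of trace 0 vanishes.

  For this \<open>M\<close> the minimizing feedback turns the Bellman inequality into an equality, so its cost is
  at most \<open>x'Mx\<close>; the lower bound makes it exactly \<open>x'Mx\<close>, which is then the attained value
  function. Any other feasible \<open>N\<close> lies below the value function, so \<open>M - N\<close> is positive
  semidefinite; this gives optimality of \<open>M\<close> over all symmetric matrices and, again by the trace
  argument, uniqueness.
\<close>

section \<open>Orbits of Schur stable matrices\<close>

text \<open>Adding up the recursion bounds \<open>(1 - \<rho>)\<close> times each partial sum of \<open>a\<close> by
  \<open>a 0 + suminf b\<close>. Both the decay of stable orbits and the decay of states with finite cost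
  are reduced to such a scalar recursion.\<close>

lemma summable_of_contractive_recursion:
  fixes a b :: "nat \<Rightarrow> real"
  assumes nonneg: "\<And>k. 0 \<le> a k" "\<And>k. 0 \<le> b k" and "\<rho> < 1"
    and step: "\<And>k. a (Suc k) \<le> \<rho> * a k + b k" and "summable b"
  shows "summable a"
proof (rule summableI_nonneg_bounded)
  have partial: "(1 - \<rho>) * (\<Sum>k<n. a k) + a n \<le> a 0 + (\<Sum>k<n. b k)" for n
  proof (induction n)
    case (Suc n)
    then show ?case using step[of n] by (simp add: algebra_simps)
  qed simp
  show "(\<Sum>k<n. a k) \<le> (a 0 + suminf b) / (1 - \<rho>)" for n
  proof -
    have "(\<Sum>k<n. b k) \<le> suminf b"
      by (rule sum_le_suminf) (use assms in auto)
    then have "(1 - \<rho>) * (\<Sum>k<n. a k) \<le> a 0 + suminf b"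
      using partial[of n] nonneg(1)[of n] by linarith
    then show ?thesis using \<open>\<rho> < 1\<close> by (simp add: pos_le_divide_eq mult.commute)
  qed
qed (use nonneg in auto)

primrec orbit :: "'a::field^'n^'n \<Rightarrow> 'a^'n \<Rightarrow> nat \<Rightarrow> 'a^'n" where
  "orbit A v 0 = v"
| "orbit A v (Suc k) = A *v orbit A v k"

lemma orbit_shift: "orbit A (A *v v) k = A *v orbit A v k"
  by (induction k) simp_all

lemma orbit_add: "orbit A (v + w) k = orbit A v k + orbit A w k"
  by (induction k) (simp_all add: matrix_vector_right_distrib)

lemma orbit_vector_scale: "orbit A (c *s v) k = c *s orbit A v k"
  by (induction k) (simp_all add: vector_scalar_commute)

text \<open>The vector \<open>p(A) v\<close>, evaluated by Horner's rule, which avoids powers of matrices and makes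
  induction over \<open>p\<close> immediate.\<close>

definition poly_apply :: "'a::field poly \<Rightarrow> 'a^'n^'n \<Rightarrow> 'a^'n \<Rightarrow> 'a^'n" where
  "poly_apply p A v = fold_coeffs (\<lambda>c w. c *s v + A *v w) p 0"

lemma poly_apply_0 [simp]: "poly_apply 0 A v = 0"
  by (simp add: poly_apply_def)

lemma poly_apply_pCons [simp]: "poly_apply (pCons c p) A v = c *s v + A *v poly_apply p A v"
proof (cases "c = 0 \<and> p = 0")
  case False
  then show ?thesis
    by (cases "p = 0")
      (simp_all add: poly_apply_def fold_coeffs_pCons_coeff_not_0_eq fold_coeffs_pCons_not_0_0_eq)
qed (auto simp: poly_apply_def)

lemma poly_apply_add: "poly_apply (p + q) A v = poly_apply p A v + poly_apply q A v"
  by (induction p q rule: poly_induct2)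
    (simp_all add: matrix_vector_right_distrib vector_sadd_rdistrib algebra_simps)

lemma poly_apply_smult: "poly_apply (smult c p) A v = c *s poly_apply p A v"
  by (induction p) (simp_all add: vector_add_ldistrib vector_scalar_commute vector_smult_assoc)

lemma poly_apply_shift: "poly_apply p A (A *v v) = A *v poly_apply p A v"
  by (induction p) (simp_all add: matrix_vector_right_distrib vector_scalar_commute)

lemma poly_apply_diff_vector: "poly_apply p A (v - w) = poly_apply p A v - poly_apply p A w"
  by (induction p) (simp_all add: matrix_vector_mult_diff_distrib vector_ssub_ldistrib add_diff_add)

lemma poly_apply_scale_vector: "poly_apply p A (c *s v) = c *s poly_apply p A v"
  by (induction p) (simp_all add: vector_scalar_commute vector_smult_assoc vector_add_ldistrib mult.commute)

lemma poly_apply_linear_factor: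
  "poly_apply ([:- \<mu>, 1:] * q) A v = A *v poly_apply q A v - \<mu> *s poly_apply q A v"
proof -
  have "[:- \<mu>, 1:] * q = smult (- \<mu>) q + pCons 0 q" by simp
  then show ?thesis
    by (simp only: poly_apply_add poly_apply_smult poly_apply_pCons) (simp add: vec_eq_iff)
qed

lemma poly_apply_monom: "poly_apply (monom c i) A v = c *s orbit A v i"
  by (induction i) (simp_all add: monom_0 monom_Suc vector_scalar_commute)

lemma poly_apply_sum: "finite S \<Longrightarrow> poly_apply (\<Sum>i\<in>S. f i) A v = (\<Sum>i\<in>S. poly_apply (f i) A v)"
  by (induction S rule: finite_induct) (simp_all add: poly_apply_add)

text \<open>More vectors \<open>A\<^sup>i v\<close> than the real dimension of the space are linearly dependent, and a
  dependence is a polynomial that annihilates \<open>v\<close>.\<close>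

lemma annihilating_poly_exists:
  fixes A :: "complex^'n^'n"
  shows "\<exists>p. p \<noteq> 0 \<and> poly_apply p A v = 0"
proof -
  let ?N = "DIM(complex^'n)"
  let ?f = "orbit A v"
  show ?thesis
  (* A repeated vector must be treated apart, because dependence is a property of sets. *)
  proof (cases "inj_on ?f {..?N}")
    case False
    then obtain i j where ij: "i \<noteq> j" "?f i = ?f j" by (auto simp: inj_on_def)
    let ?p = "monom 1 i + monom (-1) j :: complex poly"
    have "coeff ?p i = 1" using ij(1) by simp
    then have "?p \<noteq> 0" by (metis coeff_0 zero_neq_one)
    moreover have "poly_apply ?p A v = 0"
      using ij(2) by (simp add: poly_apply_add poly_apply_monom)
    ultimately show ?thesis by blast
  next
    case True
    have "card (?f ` {..?N}) = Suc ?N" by (simp only: card_image[OF True] card_atMost)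
    then have "dependent (?f ` {..?N})"
      by (intro dependent_biggerset) simp
    then obtain u where u: "\<exists>w\<in>?f ` {..?N}. u w \<noteq> 0" "(\<Sum>w\<in>?f ` {..?N}. u w *\<^sub>R w) = 0"
      by (auto simp: dependent_finite)
    then obtain i0 where i0: "i0 \<le> ?N" "u (?f i0) \<noteq> 0" by auto
    let ?p = "\<Sum>i\<le>?N. monom (complex_of_real (u (?f i))) i"
    have "coeff ?p i0 = of_real (u (?f i0))"
      using i0(1) by (simp add: coeff_sum)
    then have nz: "?p \<noteq> 0" using i0(2) by (metis coeff_0 of_real_eq_0_iff)
    have "poly_apply ?p A v = (\<Sum>i\<le>?N. u (?f i) *\<^sub>R ?f i)"
      unfolding poly_apply_sum[OF finite_atMost]
      by (rule sum.cong) (simp_all add: poly_apply_monom vec_eq_iff scaleR_conv_of_real[where 'a = complex])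
    also have "\<dots> = 0"
      using u(2) by (simp only: sum.reindex[OF True] o_def)
    finally show ?thesis using nz by blast
  qed
qed

lemma norm_vector_scale: "norm (c *s v) = cmod c * norm v"
  by (simp add: norm_vec_def norm_mult L2_set_right_distrib)

text \<open>The roots of an annihilating polynomial are removed one at a time. Let
  \<open>p(A) v = 0\<close> with \<open>p = (X - \<mu>) q\<close>. If \<open>\<mu>\<close> lies outside the open unit disc it is no
  eigenvalue, so already \<open>q(A) v = 0\<close>. Otherwise \<open>q\<close> annihilates \<open>w = A v - \<mu> v\<close>, the orbit of
  \<open>w\<close> is summable by induction, and \<open>A\<^sup>k\<^sup>+\<^sup>1 v = \<mu> A\<^sup>k v + A\<^sup>k w\<close> is a contractive recursion for the
  orbit of \<open>v\<close>.\<close>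

lemma summable_complex_orbit:
  fixes A :: "complex^'n^'n"
  assumes stable: "\<And>\<mu> v. v \<noteq> 0 \<Longrightarrow> A *v v = \<mu> *s v \<Longrightarrow> cmod \<mu> < 1"
  shows "summable (\<lambda>k. norm (orbit A v k))"
proof -
  have "p \<noteq> 0 \<Longrightarrow> poly_apply p A v = 0 \<Longrightarrow> summable (\<lambda>k. norm (orbit A v k))" for p v
  proof (induction "degree p" arbitrary: p v)
    case 0
    then obtain c where "p = [:c:]" by (metis degree_eq_zeroE)
    with 0 have "v = 0" by simp
    have "orbit A 0 k = 0" for k by (induction k) simp_all
    then show ?case by (simp add: \<open>v = 0\<close>)
  next
    case (Suc n)
    have "\<not> constant (poly p)" using Suc(2) by (simp add: constant_degree)
    then obtain \<mu> where "poly p \<mu> = 0" using fundamental_theorem_of_algebra by blast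
    then obtain q where p: "p = [:- \<mu>, 1:] * q" by (metis dvdE poly_eq_0_iff_dvd)
    have q0: "q \<noteq> 0" using Suc(3) p by auto
    have degq: "n = degree q"
    proof -
      have "degree p = degree [:- \<mu>, 1:] + degree q"
        unfolding p by (rule degree_mult_eq) (use q0 in auto)
      then show ?thesis using Suc(2) by simp
    qed
    have root: "A *v poly_apply q A v - \<mu> *s poly_apply q A v = 0"
      using Suc(4) by (simp only: p poly_apply_linear_factor)
    show ?case
    proof (cases "cmod \<mu> < 1")
      case False
      have "A *v poly_apply q A v = \<mu> *s poly_apply q A v" using root by simp
      then have "poly_apply q A v = 0" using stable[of "poly_apply q A v" \<mu>] False by blast
      then show ?thesis using Suc(1)[OF degq q0] by blast
    next
      case True
      let ?w = "A *v v - \<mu> *s v"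
      have "poly_apply q A ?w = 0"
        using root by (simp add: poly_apply_diff_vector poly_apply_shift poly_apply_scale_vector)
      then have w: "summable (\<lambda>k. norm (orbit A ?w k))" using Suc(1)[OF degq q0] by blast
      have "norm (orbit A v (Suc k)) \<le> cmod \<mu> * norm (orbit A v k) + norm (orbit A ?w k)" for k
      proof -
        have "orbit A v (Suc k) = orbit A (\<mu> *s v + ?w) k"
          by (simp add: orbit_shift)
        also have "\<dots> = \<mu> *s orbit A v k + orbit A ?w k"
          by (simp only: orbit_add orbit_vector_scale)
        finally have "norm (orbit A v (Suc k)) \<le> norm (\<mu> *s orbit A v k) + norm (orbit A ?w k)"
          by (simp only: norm_triangle_ineq)
        then show ?thesis by (simp only: norm_vector_scale)
      qed
      then show ?thesis
        by (rule summable_of_contractive_recursion[OF _ _ True _ w, rotated -1]) simp_all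
    qed
  qed
  then show ?thesis using annihilating_poly_exists by blast
qed

lemma summable_orbit:
  fixes A :: "real^'n^'n"
  assumes "schur_stable A"
  shows "summable (\<lambda>k. norm (orbit A x k))"
proof -
  let ?c = "\<lambda>x::real^'n. (\<chi> i. complex_of_real (x $ i))"
  let ?A = "map_matrix complex_of_real A"
  have c_mult: "?A *v ?c y = ?c (A *v y)" for y
    by (simp add: vec_eq_iff matrix_vector_mult_def)
  have "orbit ?A (?c x) k = ?c (orbit A x k)" for k
    by (induction k) (simp_all add: c_mult)
  moreover have "norm (?c y) = norm y" for y
    by (simp add: norm_vec_def)
  moreover have "summable (\<lambda>k. norm (orbit ?A (?c x) k))"
    using assms unfolding schur_stable_def by (intro summable_complex_orbit) blast
  ultimately show ?thesis by simp
qed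

lemma summable_power2:
  fixes a :: "nat \<Rightarrow> real"
  assumes "summable a" "\<And>k. 0 \<le> a k"
  shows "summable (\<lambda>k. (a k)\<^sup>2)"
proof (rule summable_comparison_test_ev)
  have "a \<longlonglongrightarrow> 0" using assms(1) by (rule summable_LIMSEQ_zero)
  then have "\<forall>\<^sub>F k in sequentially. a k < 1" by (rule order_tendstoD) simp
  then show "\<forall>\<^sub>F k in sequentially. norm ((a k)\<^sup>2) \<le> a k"
    by eventually_elim (simp add: assms(2) power2_eq_square mult_left_le)
qed fact

text \<open>The norm \<open>N y = (\<Sum>k. norm (A\<^sup>k y))\<close> is adapted to \<open>A\<close>: since \<open>N (A y) = N y - norm y\<close> and
  \<open>N\<close> is at most a multiple of \<open>norm\<close>, the matrix \<open>A\<close> is a strict contraction for \<open>N\<close>. As the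
  disturbance is only square summable, the resulting recursion has to be squared.\<close>

lemma stable_driven_tendsto_0:
  fixes A :: "real^'n^'n"
  assumes "schur_stable A" and rec: "\<And>k. x (Suc k) = A *v x k + w k"
    and w: "summable (\<lambda>k. (norm (w k))\<^sup>2)"
  shows "x \<longlonglongrightarrow> 0"
proof -
  define N where "N y = (\<Sum>k. norm (orbit A y k))" for y
  have summ: "summable (\<lambda>k. norm (orbit A y k))" for y
    using assms(1) by (rule summable_orbit)
  have N_nonneg: "0 \<le> N y" for y unfolding N_def by (intro suminf_nonneg summ) simp
  have N_step: "N y = norm y + N (A *v y)" for y
    using suminf_split_head[OF summ[of y]] by (simp add: N_def orbit_shift)
  have N_ge: "norm y \<le> N y" for y using N_step[of y] N_nonneg[of "A *v y"] by simp
  have N_triangle: "N (y + z) \<le> N y + N z" for y z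
  proof -
    have "N (y + z) \<le> (\<Sum>k. norm (orbit A y k) + norm (orbit A z k))"
      unfolding N_def
      by (intro suminf_le summ summable_add) (simp add: orbit_add norm_triangle_ineq)
    also have "\<dots> = N y + N z" unfolding N_def by (rule suminf_add[symmetric]) (rule summ)+
    finally show ?thesis .
  qed
  have N_scale: "N (c *s y) = \<bar>c\<bar> * N y" for c y
  proof -
    have "norm (orbit A (c *s y) k) = \<bar>c\<bar> * norm (orbit A y k)" for k
      by (simp only: orbit_vector_scale) (simp add: scalar_mult_eq_scaleR)
    then show ?thesis unfolding N_def by (simp only: suminf_mult[OF summ])
  qed
  have N_sum: "N (\<Sum>i\<in>S. f i) \<le> (\<Sum>i\<in>S. N (f i))" if "finite S" for S :: "'n set" and f
    using that
  proof (induction S rule: finite_induct)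
    case empty
    then show ?case using N_scale[of 0 0] by simp
  next
    case (insert i S)
    then show ?case using N_triangle[of "f i" "sum f S"] by simp
  qed
  (* The summand 1 gives c >= 1, so that the contraction factor 1 - 1/c lies in [0, 1). *)
  define c where "c = 1 + (\<Sum>i\<in>UNIV. N (axis i 1))"
  have c1: "1 \<le> c" unfolding c_def by (simp add: sum_nonneg N_nonneg)
  have N_le: "N y \<le> c * norm y" for y
  proof -
    have "N y = N (\<Sum>i\<in>UNIV. (y $ i) *s axis i 1)" by (simp add: basis_expansion)
    also have "\<dots> \<le> (\<Sum>i\<in>UNIV. \<bar>y $ i\<bar> * N (axis i 1))"
      using N_sum[of UNIV "\<lambda>i. (y $ i) *s axis i 1"] by (simp add: N_scale)
    also have "\<dots> \<le> (\<Sum>i\<in>UNIV. norm y * N (axis i 1))"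
      by (intro sum_mono mult_right_mono component_le_norm_cart N_nonneg)
    also have "\<dots> \<le> c * norm y"
      by (simp only: c_def sum_distrib_left[symmetric]) (simp add: algebra_simps)
    finally show ?thesis .
  qed
  define \<rho> where "\<rho> = 1 - 1 / c"
  have \<rho>: "0 \<le> \<rho>" "\<rho> < 1" "1 - \<rho> = 1 / c" using c1 by (auto simp: \<rho>_def)
  have N_contr: "N (A *v y) \<le> \<rho> * N y" for y
  proof -
    have "N y / c \<le> norm y" using N_le[of y] c1 by (simp add: pos_divide_le_eq mult.commute)
    then show ?thesis using N_step[of y] by (simp add: \<rho>_def left_diff_distrib)
  qed
  have sq_step: "(N (x (Suc k)))\<^sup>2 \<le> \<rho> * (N (x k))\<^sup>2 + c ^ 3 * (norm (w k))\<^sup>2" for k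
  proof -
    (* Writing the step as a convex combination of ?a and ?t makes the squared recursion keep the
       same factor \<rho>, by convexity of the square. *)
    let ?a = "N (x k)" and ?t = "c\<^sup>2 * norm (w k)"
    have "N (x (Suc k)) \<le> \<rho> * ?a + (1 - \<rho>) * ?t"
    proof -
      have "N (x (Suc k)) \<le> \<rho> * ?a + c * norm (w k)"
        using N_triangle[of "A *v x k" "w k"] N_contr[of "x k"] N_le[of "w k"] by (simp add: rec)
      then show ?thesis using c1 by (simp add: \<rho>(3) power2_eq_square)
    qed
    then have "(N (x (Suc k)))\<^sup>2 \<le> (\<rho> * ?a + (1 - \<rho>) * ?t)\<^sup>2"
      by (rule power_mono) (rule N_nonneg)
    also have "\<dots> \<le> \<rho> * ?a\<^sup>2 + (1 - \<rho>) * ?t\<^sup>2"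
    proof -
      have "\<rho> * ?a\<^sup>2 + (1 - \<rho>) * ?t\<^sup>2 - (\<rho> * ?a + (1 - \<rho>) * ?t)\<^sup>2 = \<rho> * (1 - \<rho>) * (?a - ?t)\<^sup>2"
        by (simp add: power2_eq_square algebra_simps)
      moreover have "0 \<le> \<dots>" using \<rho>(1,2) by simp
      ultimately show ?thesis by linarith
    qed
    also have "(1 - \<rho>) * ?t\<^sup>2 = c ^ 3 * (norm (w k))\<^sup>2"
      using c1 by (simp add: \<rho>(3) power2_eq_square power3_eq_cube)
    finally show ?thesis .
  qed
  have "summable (\<lambda>k. (N (x k))\<^sup>2)"
    using \<rho>(2) sq_step
    by (rule summable_of_contractive_recursion[where a = "\<lambda>k. (N (x k))\<^sup>2", rotated 2])
      (use w c1 in \<open>auto intro: summable_mult\<close>)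
  then have "(\<lambda>k. sqrt ((N (x k))\<^sup>2)) \<longlonglongrightarrow> sqrt 0"
    by (intro tendsto_real_sqrt summable_LIMSEQ_zero)
  then have "(\<lambda>k. N (x k)) \<longlonglongrightarrow> 0" by (simp add: N_nonneg)
  then show ?thesis
    by (rule Lim_null_comparison[rotated]) (simp add: N_ge)
qed

section \<open>Positive semidefinite matrices and quadratic forms\<close>

abbreviation qform :: "real^'n^'n \<Rightarrow> real^'n \<Rightarrow> real" where
  "qform M x \<equiv> x \<bullet> (M *v x)"

lemma inner_transpose_mult: "x \<bullet> (transpose A *v y) = (A *v x) \<bullet> (y :: real^'m)"
  by (metis dot_lmul_matrix inner_commute transpose_matrix_vector)

lemma symmetric_mat_inner: "symmetric_mat M \<Longrightarrow> x \<bullet> (M *v y) = y \<bullet> (M *v x)"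
  by (metis inner_commute inner_transpose_mult symmetric_mat_def)

lemma symmetric_mat_iff_entries: "symmetric_mat M \<longleftrightarrow> (\<forall>i j. M $ i $ j = M $ j $ i)"
  by (auto simp: symmetric_mat_def transpose_def vec_eq_iff)

lemma inner_axis_mult: "axis i 1 \<bullet> (M *v axis j 1) = (M :: real^'n^'n) $ i $ j"
  by (simp add: matrix_vector_mult_basis column_def inner_axis')

text \<open>The form is nonnegative at the sum and at the difference of two basis vectors. This makes the
  diagonal control the whole matrix, which gives both compactness below and the fact that trace 0
  implies \<open>M = 0\<close>.\<close>

lemma pos_semidef_entry_bound:
  assumes "pos_semidef M"
  shows "2 * \<bar>M $ i $ j\<bar> \<le> M $ i $ i + M $ j $ j"
proof -
  have sym: "M $ j $ i = M $ i $ j"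
    using assms by (simp add: pos_semidef_def symmetric_mat_iff_entries)
  have "0 \<le> qform M (axis i 1 + axis j 1)" "0 \<le> qform M (axis i 1 - axis j 1)"
    using assms by (auto simp: pos_semidef_def)
  then show ?thesis
    by (simp add: matrix_vector_right_distrib matrix_vector_mult_diff_distrib inner_add_left
        inner_add_right inner_diff_left inner_diff_right inner_axis_mult sym)
qed

lemma pos_semidef_trace_nonpos_imp_0:
  assumes psd: "pos_semidef M" and "trace M \<le> 0"
  shows "M = 0"
proof -
  have diag: "0 \<le> M $ i $ i" for i using pos_semidef_entry_bound[OF psd, of i i] by linarith
  have "(\<Sum>i\<in>UNIV. M $ i $ i) = 0"
    using assms(2) by (intro antisym sum_nonneg) (auto simp: trace_def diag)
  then have "M $ i $ i = 0" for i using sum_nonneg_eq_0_iff[of UNIV "\<lambda>i. M $ i $ i"] diag by simp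
  then have "M $ i $ j = 0" for i j using pos_semidef_entry_bound[OF psd, of i j] by simp
  then show ?thesis by (simp add: vec_eq_iff)
qed

lemma trace_scaleR: "trace (c *\<^sub>R M) = c * trace (M :: real^'n^'n)"
  by (simp add: trace_def sum_distrib_left)

lemma matrix_vector_mult_scaleR_left: "(c *\<^sub>R M) *v x = c *\<^sub>R ((M :: real^'n^'m) *v x)"
  by (simp add: scaleR_matrix_vector_assoc)

lemma matrix_vector_mult_minus_left: "(- A) *v x = - ((A :: real^'n^'m) *v x)"
  by (simp add: matrix_vector_mult_def vec_eq_iff sum_negf)

lemma pos_def_invertible: "pos_def A \<Longrightarrow> invertible A"
  unfolding invertible_left_inverse matrix_left_invertible_ker pos_def_def by fastforce

section \<open>The matrix inequality as a Bellman inequality\<close>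

lemma qform_block_mat:
  "stack x u \<bullet> (block_mat A B C D *v stack x u)
    = qform A x + x \<bullet> (B *v u) + u \<bullet> (C *v x) + qform D u"
proof -
  have sum_split: "sum g (UNIV :: ('a + 'b) set) = (\<Sum>a\<in>UNIV. g (Inl a)) + (\<Sum>b\<in>UNIV. g (Inr b))"
    for g :: "'a::finite + 'b::finite \<Rightarrow> real"
    by (subst UNIV_Plus_UNIV[symmetric]) (simp add: sum.Plus del: UNIV_Plus_UNIV)
  show ?thesis
    by (simp add: inner_vec_def matrix_vector_mult_def sum_split stack_def block_mat_def
        distrib_left sum.distrib)
qed

lemma stack_cases: obtains x u where "z = stack x u"
proof
  show "z = stack (\<chi> a. z $ Inl a) (\<chi> b. z $ Inr b)"
    by (auto simp: vec_eq_iff stack_def split: sum.split)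
qed

lemma symmetric_block_mat:
  "symmetric_mat A \<Longrightarrow> transpose B = C \<Longrightarrow> symmetric_mat D \<Longrightarrow> symmetric_mat (block_mat A B C D)"
  by (auto simp: symmetric_mat_iff_entries block_mat_def transpose_def vec_eq_iff split: sum.split)

lemma symmetric_mat_add: "symmetric_mat A \<Longrightarrow> symmetric_mat B \<Longrightarrow> symmetric_mat (A + B)"
  by (simp add: symmetric_mat_iff_entries)

lemma symmetric_mat_diff: "symmetric_mat A \<Longrightarrow> symmetric_mat B \<Longrightarrow> symmetric_mat (A - B)"
  by (simp add: symmetric_mat_iff_entries)

lemma symmetric_mat_scaleR: "symmetric_mat A \<Longrightarrow> symmetric_mat (c *\<^sub>R A)"
  by (simp add: symmetric_mat_iff_entries)

lemma symmetric_mat_congruence: "symmetric_mat M \<Longrightarrow> symmetric_mat (transpose A ** M ** A)"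
  by (simp add: symmetric_mat_def matrix_transpose_mul transpose_transpose matrix_mul_assoc)

lemma symmetric_mat_gram: "symmetric_mat (transpose A ** A)"
  by (simp add: symmetric_mat_def matrix_transpose_mul transpose_transpose)

lemma qform_Q_mat:
  "stack x u \<bullet> (Q_mat F G H R M *v stack x u)
    = stage_cost H R x u + qform M (F *v x + G *v u)"
  unfolding Q_mat_def matrix_vector_mult_add_rdistrib inner_add_right qform_block_mat
  by (simp add: stage_cost_def power2_norm_eq_inner inner_transpose_mult inner_add_left inner_add_right
      matrix_vector_right_distrib del: transpose_matrix_vector flip: matrix_vector_mul_assoc)

text \<open>Every vector of the product space is stacked, so the matrix inequality says no more than the
  nonnegativity of its form at stacked vectors, where it becomes the Bellman inequality.\<close>

lemma program_feasible_iff: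
  fixes F :: "real^'n^'n" and G :: "real^'m^'n" and H :: "real^'n^'p" and R :: "real^'m^'m"
  assumes "symmetric_mat R"
  shows "M \<in> program_feasible F G H R \<longleftrightarrow>
    symmetric_mat M \<and> (\<forall>x u. qform M x \<le> stage_cost H R x u + qform M (F *v x + G *v u))"
proof -
  let ?D = "Q_mat F G H R M - block_mat M 0 0 0"
  have form: "stack x u \<bullet> (?D *v stack x u)
      = stage_cost H R x u + qform M (F *v x + G *v u) - qform M x" for x u
    by (simp add: matrix_vector_mult_diff_rdistrib inner_diff_right qform_block_mat qform_Q_mat)
  have zero: "transpose 0 = (0 :: real^'m^'n)" "symmetric_mat (0 :: real^'m^'m)"
    by (simp_all add: transpose_def vec_eq_iff symmetric_mat_iff_entries)
  have "symmetric_mat ?D" if M: "symmetric_mat M"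
  proof -
    have cross: "transpose (transpose F ** M ** G) = transpose G ** M ** F"
      using M by (simp add: matrix_transpose_mul transpose_transpose symmetric_mat_def matrix_mul_assoc)
    have zero': "transpose 0 = (0 :: real^'n^'m)"
      by (simp add: transpose_def vec_eq_iff)
    show ?thesis
      unfolding Q_mat_def
      by (intro symmetric_mat_add symmetric_mat_diff symmetric_block_mat symmetric_mat_gram
          symmetric_mat_congruence cross zero zero' assms M)
  qed
  moreover have "(\<forall>z. 0 \<le> z \<bullet> (?D *v z)) \<longleftrightarrow> (\<forall>x u. 0 \<le> stack x u \<bullet> (?D *v stack x u))"
    by (metis stack_cases)
  ultimately show ?thesis
    unfolding program_feasible_def loewner_ge_def pos_semidef_def mem_Collect_eq form
    by auto
qed

section \<open>The Riccati operator\<close>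

definition riccati_weight :: "real^'m^'n \<Rightarrow> real^'m^'m \<Rightarrow> real^'n^'n \<Rightarrow> real^'m^'m" where
  "riccati_weight G R M = R + transpose G ** M ** G"

definition riccati_gain :: "real^'n^'n \<Rightarrow> real^'m^'n \<Rightarrow> real^'m^'m \<Rightarrow> real^'n^'n \<Rightarrow> real^'n^'m" where
  "riccati_gain F G R M = - (matrix_inv (riccati_weight G R M) ** transpose G ** M ** F)"

definition riccati :: "real^'n^'n \<Rightarrow> real^'m^'n \<Rightarrow> real^'n^'p \<Rightarrow> real^'m^'m \<Rightarrow> real^'n^'n \<Rightarrow> real^'n^'n" where
  "riccati F G H R M = transpose F ** M ** F + transpose H ** H
     - transpose F ** M ** G ** matrix_inv (riccati_weight G R M) ** transpose G ** M ** F"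

lemma pos_def_riccati_weight:
  assumes "pos_def R" "pos_semidef M"
  shows "pos_def (riccati_weight G R M)"
proof -
  have "0 < qform (riccati_weight G R M) u" if "u \<noteq> 0" for u
  proof -
    have "0 < qform R u" using assms(1) that by (simp add: pos_def_def)
    moreover have "0 \<le> qform M (G *v u)" using assms(2) by (simp add: pos_semidef_def)
    ultimately show ?thesis
      by (simp add: riccati_weight_def matrix_vector_mult_add_rdistrib inner_add_right
          inner_transpose_mult del: transpose_matrix_vector flip: matrix_vector_mul_assoc)
  qed
  moreover have "symmetric_mat (riccati_weight G R M)"
    using assms unfolding riccati_weight_def pos_def_def pos_semidef_def
    by (intro symmetric_mat_add symmetric_mat_congruence) auto
  ultimately show ?thesis by (simp add: pos_def_def)
qed

lemma matrix_inv_cancel: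
  assumes "invertible (A :: real^'n^'n)"
  shows "A ** matrix_inv A = mat 1" "matrix_inv A ** A = mat 1"
  using someI_ex[OF assms[unfolded invertible_def]] by (auto simp: matrix_inv_def)

lemma symmetric_matrix_inv:
  assumes "invertible A" "symmetric_mat A"
  shows "symmetric_mat (matrix_inv A)"
proof -
  let ?B = "matrix_inv A"
  have "transpose ?B ** A = mat 1"
    using arg_cong[OF matrix_inv_cancel(1)[OF assms(1)], of transpose] assms(2)
    by (simp add: matrix_transpose_mul symmetric_mat_def transpose_mat)
  then have "transpose ?B ** (A ** ?B) = ?B" by (simp add: matrix_mul_assoc)
  then show ?thesis using matrix_inv_cancel(1)[OF assms(1)] by (simp add: symmetric_mat_def)
qed

lemma symmetric_riccati:
  assumes "pos_def R" "pos_semidef M"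
  shows "symmetric_mat (riccati F G H R M)"
proof -
  let ?V = "matrix_inv (riccati_weight G R M)"
  have W: "pos_def (riccati_weight G R M)" by (rule pos_def_riccati_weight[OF assms])
  have V: "symmetric_mat ?V"
    by (rule symmetric_matrix_inv) (use W pos_def_invertible in \<open>auto simp: pos_def_def\<close>)
  have M: "symmetric_mat M" using assms(2) by (simp add: pos_semidef_def)
  have "transpose F ** M ** G ** ?V ** transpose G ** M ** F
      = transpose (transpose G ** M ** F) ** ?V ** (transpose G ** M ** F)"
    using M by (simp add: matrix_transpose_mul transpose_transpose symmetric_mat_def matrix_mul_assoc)
  then have "symmetric_mat (transpose F ** M ** G ** ?V ** transpose G ** M ** F)"
    using symmetric_mat_congruence[OF V] by metis
  then show ?thesis
    unfolding riccati_def
    by (intro symmetric_mat_diff symmetric_mat_add symmetric_mat_congruence symmetric_mat_gram M)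
qed

text \<open>The weight of the square is positive definite, so the form of \<open>riccati F G H R M\<close> is the minimum
  over \<open>u\<close> of one stage cost plus the terminal cost \<open>M\<close>, attained at the Riccati gain.\<close>

lemma completion_of_squares:
  assumes "pos_def R" "pos_semidef M"
  shows "stage_cost H R x u + qform M (F *v x + G *v u)
    = qform (riccati F G H R M) x
      + qform (riccati_weight G R M) (u - riccati_gain F G R M *v x)"
proof -
  let ?W = "riccati_weight G R M"
  let ?V = "matrix_inv ?W"
  have W: "pos_def ?W" by (rule pos_def_riccati_weight[OF assms])
  then have symW: "symmetric_mat ?W" by (simp add: pos_def_def)
  have M: "symmetric_mat M" using assms(2) by (simp add: pos_semidef_def)
  (* All cross terms are expressed by y, so that the inverse weight V enters only through V y. *)
  define y where "y = transpose G *v (M *v (F *v x))"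
  have WV: "?W *v (?V *v y) = y"
    by (simp add: matrix_vector_mul_assoc matrix_inv_cancel(1)[OF pos_def_invertible[OF W]])
  have gain: "riccati_gain F G R M *v x = - (?V *v y)"
    by (simp add: riccati_gain_def y_def matrix_vector_mul_assoc matrix_mul_assoc
        matrix_vector_mult_minus_left del: transpose_matrix_vector)
  have uy: "u \<bullet> y = (G *v u) \<bullet> (M *v (F *v x))"
    unfolding y_def by (rule inner_transpose_mult)
  have square: "qform ?W (u - riccati_gain F G R M *v x) = qform ?W u + 2 * (u \<bullet> y) + (?V *v y) \<bullet> y"
    using symmetric_mat_inner[OF symW, of "?V *v y" u]
    by (simp add: gain matrix_vector_right_distrib WV inner_add_left inner_add_right)
  have ric: "qform (riccati F G H R M) x = qform M (F *v x) + (norm (H *v x))\<^sup>2 - (?V *v y) \<bullet> y"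
  proof -
    have "x \<bullet> ((transpose F ** M ** G ** ?V ** transpose G ** M ** F) *v x)
        = (F *v x) \<bullet> (M *v (G *v (?V *v y)))"
      by (simp add: y_def inner_transpose_mult del: transpose_matrix_vector
          flip: matrix_vector_mul_assoc)
    also have "\<dots> = (?V *v y) \<bullet> y"
      unfolding symmetric_mat_inner[OF M, of "F *v x"] y_def inner_transpose_mult ..
    finally show ?thesis
      by (simp add: riccati_def matrix_vector_mult_add_rdistrib matrix_vector_mult_diff_rdistrib
          inner_add_right inner_diff_right power2_norm_eq_inner inner_transpose_mult
          del: transpose_matrix_vector flip: matrix_vector_mul_assoc)
  qed
  have Wu: "qform ?W u = qform R u + qform M (G *v u)"
    by (simp add: riccati_weight_def matrix_vector_mult_add_rdistrib inner_add_right
        inner_transpose_mult del: transpose_matrix_vector flip: matrix_vector_mul_assoc)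
  show ?thesis
    unfolding square ric Wu uy
    using symmetric_mat_inner[OF M, of "F *v x" "G *v u"]
    by (simp add: stage_cost_def matrix_vector_right_distrib inner_add_left inner_add_right)
qed

section \<open>States of finite total cost\<close>

lemma stage_cost_nonneg: "pos_def R \<Longrightarrow> 0 \<le> stage_cost H R x u"
  unfolding stage_cost_def pos_def_def by (cases "u = 0") (auto intro: less_imp_le)

lemma pos_def_coercive:
  fixes R :: "real^'n^'n"
  assumes "pos_def R"
  shows "\<exists>r>0. \<forall>u. r * (norm u)\<^sup>2 \<le> qform R u"
proof -
  have cont: "continuous_on (sphere 0 1) (qform R)"
    by (intro continuous_intros linear_continuous_on matrix_vector_mul_bounded_linear)
  have "(axis undefined 1 :: real^'n) \<in> sphere 0 1" by (simp only: mem_sphere_0 norm_axis_1)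
  then obtain s where s: "s \<in> sphere 0 1" "\<And>y. y \<in> sphere 0 1 \<Longrightarrow> qform R s \<le> qform R y"
    using continuous_attains_inf[OF compact_sphere _ cont] by blast
  show ?thesis
  proof (intro exI conjI allI)
    have "s \<noteq> 0" using s(1) by auto
    then show "0 < qform R s" using assms by (simp add: pos_def_def)
    show "qform R s * (norm u)\<^sup>2 \<le> qform R u" for u
    proof (cases "u = 0")
      case False
      then have "qform R s \<le> qform R ((1 / norm u) *\<^sub>R u)" by (intro s(2)) simp
      then show ?thesis
        using False by (simp add: matrix_vector_mult_scaleR power2_eq_square field_simps)
    qed simp
  qed
qed

lemma norm_matrix_vector_le: "norm (A *v x) \<le> onorm ((*v) A) * norm (x :: real^'n)"
  by (rule onorm[OF matrix_vector_mul_bounded_linear])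

lemma qform_le: "qform P x \<le> onorm ((*v) P) * (norm x)\<^sup>2"
proof -
  have "qform P x \<le> norm x * norm (P *v x)" by (rule norm_cauchy_schwarz)
  also have "\<dots> \<le> norm x * (onorm ((*v) P) * norm x)"
    by (intro mult_left_mono norm_matrix_vector_le) simp
  finally show ?thesis by (simp add: power2_eq_square mult_ac)
qed

lemma power2_norm_diff_le: "(norm (a - b))\<^sup>2 \<le> 2 * (norm a)\<^sup>2 + 2 * (norm (b :: 'a::real_inner))\<^sup>2"
proof -
  have "0 \<le> (norm (a + b))\<^sup>2" by simp
  then show ?thesis
    by (simp add: power2_norm_eq_inner inner_add_left inner_add_right inner_diff_left
        inner_diff_right inner_commute)
qed

text \<open>Output injection rewrites the dynamics as the stable matrix \<open>F + L H\<close> driven by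
  \<open>G u - L H x\<close>. The stage cost dominates the squares of both \<open>u\<close> and \<open>H x\<close>, hence the square of
  this driving term, and it is summable.\<close>

lemma finite_cost_state_tendsto_0:
  fixes F :: "real^'n^'n" and G :: "real^'m^'n" and H :: "real^'n^'p" and R :: "real^'m^'m"
  assumes R: "pos_def R" and "detectable F H"
    and cost: "summable (\<lambda>k. stage_cost H R (state_traj F G x u k) (u k))"
  shows "state_traj F G x u \<longlonglongrightarrow> 0"
proof -
  obtain L :: "real^'p^'n" where L: "schur_stable (F + L ** H)"
    using assms(2) by (auto simp: detectable_def)
  obtain r where r: "0 < r" "\<And>u. r * (norm u)\<^sup>2 \<le> qform R u"
    using pos_def_coercive[OF R] by blast
  let ?x = "state_traj F G x u"
  let ?c = "\<lambda>k. stage_cost H R (?x k) (u k)"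
  have out: "(norm (H *v ?x k))\<^sup>2 \<le> ?c k" for k
  proof -
    have "0 \<le> r * (norm (u k))\<^sup>2" using r(1) by simp
    then show ?thesis using r(2)[of "u k"] by (simp add: stage_cost_def)
  qed
  have inp: "r * (norm (u k))\<^sup>2 \<le> ?c k" for k
    using r(2)[of "u k"] by (simp add: stage_cost_def add_increasing)
  define w where "w k = G *v u k - L *v (H *v ?x k)" for k
  let ?g = "onorm ((*v) G)" and ?l = "onorm ((*v) L)"
  have w_le: "(norm (w k))\<^sup>2 \<le> (2 * ?g\<^sup>2 / r + 2 * ?l\<^sup>2) * ?c k" for k
  proof -
    have "(norm (G *v u k))\<^sup>2 \<le> ?g\<^sup>2 * (norm (u k))\<^sup>2"
      by (metis norm_matrix_vector_le norm_ge_zero power_mono power_mult_distrib)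
    also have "\<dots> \<le> ?g\<^sup>2 * (?c k / r)"
      using inp[of k] r(1) by (intro mult_left_mono) (simp_all add: pos_le_divide_eq mult.commute)
    finally have "2 * (norm (G *v u k))\<^sup>2 \<le> 2 * ?g\<^sup>2 / r * ?c k" by simp
    moreover have "(norm (L *v (H *v ?x k)))\<^sup>2 \<le> ?l\<^sup>2 * (norm (H *v ?x k))\<^sup>2"
      by (metis norm_matrix_vector_le norm_ge_zero power_mono power_mult_distrib)
    then have "2 * (norm (L *v (H *v ?x k)))\<^sup>2 \<le> 2 * ?l\<^sup>2 * ?c k"
      using mult_left_mono[OF out[of k], of "?l\<^sup>2"] by simp
    ultimately show ?thesis
      using power2_norm_diff_le[of "G *v u k" "L *v (H *v ?x k)"]
      unfolding w_def distrib_right by linarith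
  qed
  have "summable (\<lambda>k. (norm (w k))\<^sup>2)"
  proof (rule summable_comparison_test')
    show "summable (\<lambda>k. (2 * ?g\<^sup>2 / r + 2 * ?l\<^sup>2) * ?c k)" using cost by (rule summable_mult)
    show "norm ((norm (w k))\<^sup>2) \<le> (2 * ?g\<^sup>2 / r + 2 * ?l\<^sup>2) * ?c k" if "k \<ge> 0" for k
      using w_le[of k] by simp
  qed
  moreover have "?x (Suc k) = (F + L ** H) *v ?x k + w k" for k
    by (simp add: w_def matrix_vector_mult_add_rdistrib matrix_vector_mul_assoc)
  ultimately show ?thesis using stable_driven_tendsto_0[OF L] by blast
qed

lemma feasible_qform_le_finite_horizon:
  assumes "\<And>x u. qform M x \<le> stage_cost H R x u + qform M (F *v x + G *v u)"
  shows "qform M x \<le> (\<Sum>k<N. stage_cost H R (state_traj F G x u k) (u k))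
    + qform M (state_traj F G x u N)"
proof (induction N)
  case (Suc N)
  then show ?case using assms[of "state_traj F G x u N" "u N"] by simp
qed simp

section \<open>Feasible matrices are lower bounds of the cost\<close>

text \<open>The form of \<open>M\<close> may be negative at some states, so the terminal term of the finite horizon bound
  cannot be discarded by its sign; it tends to 0 with the state.\<close>

lemma feasible_qform_le_total_cost:
  assumes R: "pos_def R" and "detectable F H" and M: "M \<in> program_feasible F G H R"
  shows "ereal (qform M x) \<le> total_cost F G H R x u"
proof (cases "total_cost F G H R x u = \<infinity>")
  case False
  let ?x = "state_traj F G x u"
  let ?c = "\<lambda>k. stage_cost H R (?x k) (u k)"
  have c0: "0 \<le> ?c k" for k using R by (rule stage_cost_nonneg)
  have fin: "(\<Sum>k. ereal (?c k)) \<noteq> \<infinity>" using False by (simp add: total_cost_def)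
  have summ: "summable ?c" by (rule summable_ereal[OF c0 fin])
  have bellman: "qform M x \<le> stage_cost H R x u + qform M (F *v x + G *v u)" for x u
    using M R by (auto simp: program_feasible_iff pos_def_def)
  have lim: "?x \<longlonglongrightarrow> 0" by (rule finite_cost_state_tendsto_0[OF R assms(2) summ])
  have "continuous_on UNIV (qform M)"
    by (intro continuous_intros linear_continuous_on matrix_vector_mul_bounded_linear)
  then have "(\<lambda>N. qform M (?x N)) \<longlonglongrightarrow> qform M 0"
    by (rule continuous_on_tendsto_compose[OF _ lim]) simp_all
  then have "(\<lambda>N. (\<Sum>k<N. ?c k) + qform M (?x N)) \<longlonglongrightarrow> suminf ?c + 0"
    by (intro tendsto_add summable_LIMSEQ[OF summ]) simp
  then have "qform M x \<le> suminf ?c + 0"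
    by (rule LIMSEQ_le_const) (use feasible_qform_le_finite_horizon[OF bellman] in blast)
  moreover have "total_cost F G H R x u = ereal (suminf ?c)"
    unfolding total_cost_def by (rule suminf_ereal[OF c0 fin])
  ultimately show ?thesis by simp
qed simp

section \<open>Feedback inputs\<close>

text \<open>The open-loop input sequence that the feedback law \<open>u = K x\<close> generates from the initial state
  \<open>x\<close>.\<close>

definition feedback_input :: "real^'n^'n \<Rightarrow> real^'m^'n \<Rightarrow> real^'n^'m \<Rightarrow> real^'n \<Rightarrow> nat \<Rightarrow> real^'m" where
  "feedback_input F G K x k = K *v orbit (F + G ** K) x k"

lemma state_traj_feedback: "state_traj F G x (feedback_input F G K x) k = orbit (F + G ** K) x k"
  by (induction k)
    (simp_all add: feedback_input_def matrix_vector_mult_add_rdistrib matrix_vector_mul_assoc)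

lemma finite_cost_input_exists:
  fixes F :: "real^'n^'n" and G :: "real^'m^'n" and H :: "real^'n^'p" and R :: "real^'m^'m"
  assumes "pos_def R" "stabilizable F G"
  shows "\<exists>u. total_cost F G H R x u \<noteq> \<infinity>"
proof -
  obtain K where K: "schur_stable (F + G ** K)" using assms(2) by (auto simp: stabilizable_def)
  let ?u = "feedback_input F G K x" and ?y = "orbit (F + G ** K) x"
  let ?P = "transpose H ** H + transpose K ** R ** K"
  have cost_eq: "stage_cost H R y (K *v y) = qform ?P y" for y
    by (simp add: stage_cost_def power2_norm_eq_inner inner_transpose_mult inner_add_right
        matrix_vector_mult_add_rdistrib del: transpose_matrix_vector flip: matrix_vector_mul_assoc)
  have "summable (\<lambda>k. stage_cost H R (?y k) (K *v ?y k))"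
  proof (rule summable_comparison_test')
    show "summable (\<lambda>k. onorm ((*v) ?P) * (norm (?y k))\<^sup>2)"
      by (intro summable_mult summable_power2 summable_orbit K) simp
    show "norm (stage_cost H R (?y k) (K *v ?y k)) \<le> onorm ((*v) ?P) * (norm (?y k))\<^sup>2"
      if "k \<ge> 0" for k
      using stage_cost_nonneg[OF assms(1), of H "?y k" "K *v ?y k"] qform_le[of "?y k" ?P]
      by (simp add: cost_eq)
  qed
  then have "total_cost F G H R x ?u \<noteq> \<infinity>"
    unfolding total_cost_def state_traj_feedback
    by (intro suminf_ereal_finite) (simp add: feedback_input_def)
  then show ?thesis by blast
qed

section \<open>The feasible matrix of maximal trace\<close>

lemma linear_qform: "linear (\<lambda>M. qform M x)"
  by (intro linearI)
    (simp_all add: matrix_vector_mult_add_rdistrib matrix_vector_mult_scaleR_left inner_add_right)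

lemma continuous_on_qform: "continuous_on S (\<lambda>M. qform M x)"
  by (rule linear_continuous_on[OF linear_qform[unfolded linear_conv_bounded_linear]])

lemma continuous_on_trace: "continuous_on S (trace :: real^'n^'n \<Rightarrow> real)"
  unfolding trace_def by (intro continuous_intros)

text \<open>The forms of feasible matrices are bounded at each vector by the cost of some input, in particular
  at the basis vectors. This bounds the diagonals, and semidefiniteness then bounds all entries.\<close>

lemma compact_psd_feasible:
  fixes F :: "real^'n^'n"
  assumes R: "pos_def R" and "stabilizable F G" "detectable F H"
  shows "compact {M. pos_semidef M \<and> M \<in> program_feasible F G H R}" (is "compact ?C")
proof (rule compact_eq_bounded_closed[THEN iffD2], intro conjI)
  have symR: "symmetric_mat R" using R by (simp add: pos_def_def)
  have "\<exists>b. \<forall>M \<in> program_feasible F G H R. qform M x \<le> b" for x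
  proof -
    obtain u where u: "total_cost F G H R x u \<noteq> \<infinity>"
      using finite_cost_input_exists[OF assms(1,2)] by blast
    moreover have "0 \<le> total_cost F G H R x u"
      unfolding total_cost_def by (intro suminf_0_le) (simp add: stage_cost_nonneg R)
    ultimately obtain b where "total_cost F G H R x u = ereal b"
      by (cases "total_cost F G H R x u") auto
    then show ?thesis
      using feasible_qform_le_total_cost[OF R assms(3)] by (metis ereal_less_eq(3))
  qed
  then obtain b where b: "\<And>x M. M \<in> program_feasible F G H R \<Longrightarrow> qform M x \<le> b x" by metis
  let ?b = "\<lambda>i. b (axis i 1)"
  show "bounded ?C"
  proof (rule boundedI)
    fix M assume M: "M \<in> ?C"
    have diag: "M $ i $ i \<le> ?b i" for i
      using M b[of M "axis i 1"] by (simp add: inner_axis_mult)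
    have diag0: "0 \<le> M $ i $ i" for i using pos_semidef_entry_bound[of M i i] M by simp
    have entry: "\<bar>M $ i $ j\<bar> \<le> ?b i + ?b j" for i j
      using pos_semidef_entry_bound[of M i j] M diag[of i] diag[of j] diag0[of i] diag0[of j] by simp
    have "norm M \<le> (\<Sum>i\<in>UNIV. norm (M $ i))"
      unfolding norm_vec_def[of M] by (rule L2_set_le_sum) simp
    also have "\<dots> \<le> (\<Sum>i\<in>UNIV. \<Sum>j\<in>UNIV. \<bar>M $ i $ j\<bar>)"
      by (intro sum_mono norm_le_l1_cart)
    also have "\<dots> \<le> (\<Sum>i\<in>UNIV. \<Sum>j\<in>UNIV. ?b i + ?b j)"
      by (intro sum_mono entry)
    finally show "norm M \<le> (\<Sum>i\<in>UNIV. \<Sum>j\<in>UNIV. ?b i + ?b j)" .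
  qed
  have "?C = {M. (\<forall>i j. M $ i $ j = M $ j $ i) \<and> (\<forall>x. 0 \<le> qform M x)
      \<and> (\<forall>x u. qform M x \<le> stage_cost H R x u + qform M (F *v x + G *v u))}"
    by (auto simp: program_feasible_iff[OF symR] pos_semidef_def symmetric_mat_iff_entries)
  moreover have "closed \<dots>"
    by (intro closed_Collect_conj closed_Collect_all closed_Collect_eq closed_Collect_le
        continuous_intros continuous_on_qform)
  ultimately show "closed ?C" by simp
qed

text \<open>For \<open>M\<close> of maximal trace among the positive semidefinite feasible matrices, \<open>riccati F G H R M\<close>
  is again such a matrix and dominates \<open>M\<close>, so the two coincide.\<close>

lemma riccati_fixpoint_exists:
  assumes R: "pos_def R" and "stabilizable F G" "detectable F H"
  obtains M where "pos_semidef M" "M \<in> program_feasible F G H R" "riccati F G H R M = M"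
proof -
  let ?C = "{M. pos_semidef M \<and> M \<in> program_feasible F G H R}"
  have symR: "symmetric_mat R" using R by (simp add: pos_def_def)
  note feasible_iff = program_feasible_iff[OF symR]
  have "0 \<in> ?C"
    by (simp add: pos_semidef_def feasible_iff symmetric_mat_iff_entries stage_cost_nonneg R)
  then obtain M where M: "M \<in> ?C" and max: "\<And>N. N \<in> ?C \<Longrightarrow> trace N \<le> trace M"
    using continuous_attains_sup[OF compact_psd_feasible[OF assms] _ continuous_on_trace] by blast
  have psd: "pos_semidef M"
    and bellman: "\<And>x u. qform M x \<le> stage_cost H R x u + qform M (F *v x + G *v u)"
    using M by (auto simp: feasible_iff)
  let ?N = "riccati F G H R M"
  note square = completion_of_squares[OF R psd, of H _ _ F G]
  have symN: "symmetric_mat ?N" by (rule symmetric_riccati[OF R psd])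
  have mono: "qform M x \<le> qform ?N x" for x
    using bellman[of x "riccati_gain F G R M *v x"] square[of x "riccati_gain F G R M *v x"] by simp
  have N_le: "qform ?N x \<le> stage_cost H R x u + qform M (F *v x + G *v u)" for x u
  proof -
    have "0 \<le> qform (riccati_weight G R M) (u - riccati_gain F G R M *v x)"
      using pos_def_riccati_weight[OF R psd, of G]
      by (cases "u - riccati_gain F G R M *v x = 0") (auto simp: pos_def_def intro: less_imp_le)
    then show ?thesis using square[of x u] by simp
  qed
  have "pos_semidef ?N"
    using psd symN mono by (auto simp: pos_semidef_def intro: order_trans)
  moreover have "?N \<in> program_feasible F G H R"
    unfolding feasible_iff
  proof (intro conjI allI symN)
    show "qform ?N x \<le> stage_cost H R x u + qform ?N (F *v x + G *v u)" for x u
      using N_le[of x u] mono[of "F *v x + G *v u"] by linarith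
  qed
  ultimately have "trace (?N - M) \<le> 0" using max[of ?N] by (simp add: trace_sub)
  moreover have "pos_semidef (?N - M)"
    using psd symN mono
    by (simp add: pos_semidef_def symmetric_mat_diff matrix_vector_mult_diff_rdistrib inner_diff_right)
  ultimately have "?N - M = 0" by (rule pos_semidef_trace_nonpos_imp_0[rotated])
  then show thesis using that[of M] M by simp
qed

section \<open>Optimality of the Riccati feedback\<close>

text \<open>Under the optimal gain the Bellman inequality is an equality at every step, so the cost of the first
  \<open>N\<close> steps telescopes to \<open>x'Mx\<close> minus the nonnegative value of the form at the \<open>N\<close>-th state.\<close>

lemma riccati_feedback_cost_le:
  assumes R: "pos_def R" and psd: "pos_semidef M" and fixpoint: "riccati F G H R M = M"
  shows "total_cost F G H R x (feedback_input F G (riccati_gain F G R M) x) \<le> ereal (qform M x)"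
proof -
  let ?K = "riccati_gain F G R M"
  let ?y = "orbit (F + G ** ?K) x"
  let ?c = "\<lambda>k. stage_cost H R (?y k) (?K *v ?y k)"
  have telescope: "(\<Sum>k<N. ?c k) + qform M (?y N) = qform M x" for N
  proof (induction N)
    case (Suc N)
    have "?c N + qform M (F *v ?y N + G *v (?K *v ?y N)) = qform M (?y N)"
      using completion_of_squares[OF R psd, of H "?y N" "?K *v ?y N" F G] by (simp add: fixpoint)
    then show ?case
      using Suc by (simp add: matrix_vector_mult_add_rdistrib matrix_vector_mul_assoc)
  qed simp
  have "(\<Sum>k<N. ?c k) \<le> qform M x" for N
    using telescope[of N] psd by (simp add: pos_semidef_def) (smt (verit))
  then show ?thesis
    unfolding total_cost_def state_traj_feedback
    by (intro suminf_bound) (simp_all add: feedback_input_def stage_cost_nonneg R)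
qed

section \<open>The value function and the convex program\<close>

text \<open>For fixed \<open>x\<close> and \<open>u\<close> the Bellman inequality is affine in \<open>M\<close>, so the feasible set is convex.\<close>

lemma concave_on_trace_program_feasible:
  assumes "symmetric_mat R"
  shows "concave_on (program_feasible F G H R) trace"
proof -
  have "convex (program_feasible F G H R)"
  proof (rule convexI)
    fix M N and a b :: real
    assume M: "M \<in> program_feasible F G H R" and N: "N \<in> program_feasible F G H R"
      and ab: "0 \<le> a" "0 \<le> b" "a + b = 1"
    have form: "qform (a *\<^sub>R M + b *\<^sub>R N) x = a * qform M x + b * qform N x" for x
      by (simp add: matrix_vector_mult_add_rdistrib matrix_vector_mult_scaleR_left inner_add_right)
    have "a * qform M x + b * qform N x
        \<le> stage_cost H R x u + (a * qform M (F *v x + G *v u) + b * qform N (F *v x + G *v u))" for x u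
    proof -
      let ?c = "stage_cost H R x u" and ?z = "F *v x + G *v u"
      have "a * qform M x + b * qform N x \<le> a * (?c + qform M ?z) + b * (?c + qform N ?z)"
        using M N ab by (intro add_mono mult_left_mono) (auto simp: program_feasible_iff[OF assms])
      also have "\<dots> = (a + b) * ?c + (a * qform M ?z + b * qform N ?z)"
        by (simp add: algebra_simps)
      finally show ?thesis using ab(3) by simp
    qed
    then show "a *\<^sub>R M + b *\<^sub>R N \<in> program_feasible F G H R"
      using M N unfolding program_feasible_iff[OF assms] form
      by (auto intro: symmetric_mat_add symmetric_mat_scaleR)
  qed
  then show ?thesis
    by (simp add: concave_on_iff trace_add trace_scaleR)
qed

theorem proposition2p3:
  fixes F :: "real^'n^'n" and G :: "real^'m^'n" and H :: "real^'n^'p" and R :: "real^'m^'m"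
  assumes "pos_def R"
    and "stabilizable F G"
    and "detectable F H"
  shows "\<exists>Mstar :: real^'n^'n.
      pos_semidef Mstar \<and> solves_ARE F G H R Mstar
    \<and> (\<forall>x. value_fun F G H R x = ereal (x \<bullet> (Mstar *v x))
           \<and> (\<exists>u. total_cost F G H R x u = value_fun F G H R x))
    \<and> (\<forall>x u. Q_fun F G H R x u = ereal (stack x u \<bullet> (Q_mat F G H R Mstar *v stack x u)))
    \<and> concave_on (program_feasible F G H R) trace
    \<and> {M. is_arg_max trace (\<lambda>M. M \<in> program_feasible F G H R) M} = {Mstar}"
proof -
  obtain M where psd: "pos_semidef M" and feas: "M \<in> program_feasible F G H R"
    and fixpoint: "riccati F G H R M = M"
    by (rule riccati_fixpoint_exists[OF assms])
  let ?u = "feedback_input F G (riccati_gain F G R M)"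
  have symR: "symmetric_mat R" using assms(1) by (simp add: pos_def_def)
  have lower: "N \<in> program_feasible F G H R \<Longrightarrow> ereal (qform N x) \<le> total_cost F G H R x u" for N x u
    using assms(1,3) by (rule feasible_qform_le_total_cost)
  have attained: "total_cost F G H R x (?u x) = ereal (qform M x)" for x
    using riccati_feedback_cost_le[OF assms(1) psd fixpoint] lower[OF feas] by (rule antisym)
  have val: "value_fun F G H R x = ereal (qform M x)" for x
    unfolding value_fun_def
  proof (rule antisym)
    show "(INF u. total_cost F G H R x u) \<le> ereal (qform M x)"
      by (metis INF_lower UNIV_I attained)
    show "ereal (qform M x) \<le> (INF u. total_cost F G H R x u)"
      by (intro INF_greatest lower feas)
  qed
  have "solves_ARE F G H R M"
    using fixpoint pos_def_invertible[OF pos_def_riccati_weight[OF assms(1) psd, of G]]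
    unfolding solves_ARE_def riccati_def riccati_weight_def by simp
  moreover have "Q_fun F G H R x u = ereal (stack x u \<bullet> (Q_mat F G H R M *v stack x u))" for x u
    by (simp add: Q_fun_def val qform_Q_mat)
  moreover have "{N. is_arg_max trace (\<lambda>N. N \<in> program_feasible F G H R) N} = {M}"
  proof -
    have psd_diff: "pos_semidef (M - N)" if N: "N \<in> program_feasible F G H R" for N
    proof -
      have "qform N x \<le> qform M x" for x using lower[OF N, of x "?u x"] by (simp add: attained)
      then show ?thesis
        using N psd by (simp add: pos_semidef_def program_feasible_iff[OF symR] symmetric_mat_diff
            matrix_vector_mult_diff_rdistrib inner_diff_right)
    qed
    have unique: "N = M" if "N \<in> program_feasible F G H R" "trace M \<le> trace N" for N
      using pos_semidef_trace_nonpos_imp_0[OF psd_diff[OF that(1)]] that(2) by (simp add: trace_sub)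
    have "is_arg_max trace (\<lambda>N. N \<in> program_feasible F G H R) N \<longleftrightarrow> N = M" for N
      using feas unique unfolding is_arg_max_def by (metis linorder_not_le order_refl less_imp_le)
    then show ?thesis by simp
  qed
  moreover have "\<exists>u. total_cost F G H R x u = value_fun F G H R x" for x
    using attained[of x] val[of x] by metis
  ultimately show ?thesis
    using psd val concave_on_trace_program_feasible[OF symR] by blast
qed

end
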